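(* Let $(X, \tau)$ be a topological space (possibly infinite) such that $(\tau, \subseteq)$ satisfies the descending chain condition and $\tau \neq \{\emptyset\}$. Then there exists $x \in X$ that is abundant in the family $\tau$; that is, there exists $x \in X$ for which there is an injective map $\{U \in \tau : x \notin U\} \hookrightarrow \{U \in \tau : x \in U\}$.
   Context: Here $\tau$ is the collection of open sets of $X$. A poset satisfies the descending chain condition if every nonempty subset of it has a minimal element. For a family of sets $\mathcal F$ with universe $U_{\mathcal F} = \bigcup_{A \in \mathcal F} A$, an element $x \in U_{\mathcal F}$ is abundant in $\mathcal F$ if there exists an injective map of sets from $\{A \in \mathcal F : x \notin A\}$ into $\{A \in \mathcal F : x \in A\}$. *)

theory Defs
  imports "HOL-Analysis.Abstract_Topology" "HOL-Library.Equipollence"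
begin

definition descending_chain_condition :: "'a::order set \<Rightarrow> bool" where
  "descending_chain_condition P \<longleftrightarrow>
     (\<forall>S. S \<subseteq> P \<and> S \<noteq> {} \<longrightarrow> (\<exists>m\<in>S. \<forall>s\<in>S. s \<le> m \<longrightarrow> s = m))"

definition abundant :: "'a set set \<Rightarrow> 'a \<Rightarrow> bool" where
  "abundant \<F> x \<longleftrightarrow> x \<in> \<Union>\<F> \<and> {A \<in> \<F>. x \<notin> A} \<lesssim> {A \<in> \<F>. x \<in> A}"

end

theory Submission
  imports Defs
begin

text \<open>
  The descending chain condition yields a minimal nonempty open set \<open>M\<close>. By minimality every open
  set either contains \<open>M\<close> or is disjoint from it, so for \<open>x \<in> M\<close> the open sets avoiding \<open>x\<close> are
  disjoint from \<open>M\<close>. Adjoining \<open>M\<close> therefore maps them injectively (subtracting \<open>M\<close> recovers the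
  original set) to open sets containing \<open>x\<close>. Hence every point of \<open>M\<close> is abundant.
\<close>

lemma abundant_if_mem_minimal_open:
  assumes M: "openin X M" and x: "x \<in> M"
    and minimal: "\<And>V. openin X V \<Longrightarrow> V \<noteq> {} \<Longrightarrow> V \<subseteq> M \<Longrightarrow> V = M"
  shows "abundant {U. openin X U} x"
proof -
  have disjoint: "V \<inter> M = {}" if "openin X V" "x \<notin> V" for V
    using minimal[of "V \<inter> M"] openin_Int[OF that(1) M] that(2) x by blast
  have "inj_on (\<lambda>V. V \<union> M) {V \<in> {U. openin X U}. x \<notin> V}"
    by (rule inj_on_inverseI[where g = "\<lambda>W. W - M"]) (use disjoint in blast)
  moreover have "(\<lambda>V. V \<union> M) ` {V \<in> {U. openin X U}. x \<notin> V} \<subseteq> {V \<in> {U. openin X U}. x \<in> V}"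
    using M x by auto
  ultimately have "{V \<in> {U. openin X U}. x \<notin> V} \<lesssim> {V \<in> {U. openin X U}. x \<in> V}"
    unfolding lepoll_def by blast
  then show ?thesis
    unfolding abundant_def using M x by blast
qed

theorem theorem3p21:
  fixes X :: "'a topology"
  assumes "descending_chain_condition {U. openin X U}"
    and "{U. openin X U} \<noteq> {{}}"
  shows "\<exists>x\<in>topspace X. abundant {U. openin X U} x"
proof -
  let ?S = "{U. openin X U \<and> U \<noteq> {}}"
  have "?S \<noteq> {}"
    using assms(2) openin_empty[of X] by blast
  moreover have "?S \<subseteq> {U. openin X U}"
    by blast
  ultimately obtain M where M: "M \<in> ?S" and minimal: "\<forall>V\<in>?S. V \<subseteq> M \<longrightarrow> V = M"
    using assms(1) unfolding descending_chain_condition_def by meson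
  from M obtain x where x: "x \<in> M"
    by blast
  have "abundant {U. openin X U} x"
    using M minimal by (intro abundant_if_mem_minimal_open[OF _ x]) auto
  moreover have "x \<in> topspace X"
    using M x openin_subset by blast
  ultimately show ?thesis
    by blast
qed

end
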